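(* Let $G$ be a finite group with center $Z(G)$ such that $G/Z(G) \cong Sz(2)$, where $Sz(2) = \langle a, b : a^5 = b^4 = 1,\ b^{-1}ab = a^2\rangle$. Then $$\text{L-Spec}(\Gamma_G) = \{0^6,\ (4|Z(G)|)^{4|Z(G)|-1},\ (3|Z(G)|)^{15|Z(G)|-5}\}$$ and $$\text{Q-Spec}(\Gamma_G) = \{(8|Z(G)|-2)^1,\ (4|Z(G)|-2)^{4|Z(G)|-1},\ (6|Z(G)|-2)^5,\ (3|Z(G)|-2)^{15|Z(G)|-5}\}.$$
   Context: The commuting graph $\Gamma_G$ of a finite non-abelian group $G$ is the simple undirected graph with vertex set $G\setminus Z(G)$ in which two distinct vertices $x,y$ are adjacent if and only if $xy=yx$. For a finite graph $\mathcal{G}$ with adjacency matrix $A$ and (diagonal) degree matrix $D$, $\text{L-Spec}(\mathcal{G})$ and $\text{Q-Spec}(\mathcal{G})$ denote the multisets of eigenvalues (with multiplicity) of the Laplacian matrix $D-A$ and of the signless Laplacian matrix $D+A$, respectively. The notation $\{\alpha_1^{a_1},\dots,\alpha_l^{a_l}\}$ means the multiset in which $\alpha_i$ is listed $a_i$ times (if listed values coincide, their multiplicities add; an exponent $0$ means the value does not appear). *)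

theory Defs
  imports
    "HOL-Algebra.Coset"
    "Jordan_Normal_Form.Char_Poly"
    "Graph_Theory.Pair_Digraph"
begin

section \<open>Groups given by generators and relations\<close>

text \<open>
  A word over the generators \<open>'x\<close> is a list of signed letters: \<open>(x, True)\<close> stands for \<open>x\<close> and
  \<open>(x, False)\<close> for its formal inverse. Every element of the type \<open>'x\<close> is a generator. A relation
  \<open>l = r\<close> is given as the pair \<open>(l, r)\<close>.
\<close>

type_synonym 'x word = "('x \<times> bool) list"

inductive word_eq :: "('x word \<times> 'x word) set \<Rightarrow> 'x word \<Rightarrow> 'x word \<Rightarrow> bool"
  for R where
  refl: "word_eq R u u"
| sym: "word_eq R u v \<Longrightarrow> word_eq R v u"
| trans: "word_eq R u v \<Longrightarrow> word_eq R v w \<Longrightarrow> word_eq R u w"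
| cancel: "word_eq R (u @ [(x, s), (x, \<not> s)] @ v) (u @ v)"
| relation: "(l, r) \<in> R \<Longrightarrow> word_eq R (u @ l @ v) (u @ r @ v)"

definition word_class :: "('x word \<times> 'x word) set \<Rightarrow> 'x word \<Rightarrow> 'x word set" where
  "word_class R u = {v. word_eq R u v}"

definition presented_group :: "('x word \<times> 'x word) set \<Rightarrow> 'x word set monoid" where
  "presented_group R = \<lparr>
     carrier = range (word_class R),
     monoid.mult = (\<lambda>U V. \<Union>u\<in>U. \<Union>v\<in>V. word_class R (u @ v)),
     one = word_class R []\<rparr>"

datatype sz_gen = gen_a | gen_b

definition Sz2 :: "sz_gen word set monoid" where
  "Sz2 =
     (let a = (gen_a, True); b = (gen_b, True); b_inv = (gen_b, False)
      in presented_group {([a, a, a, a, a], []), ([b, b, b, b], []), ([b_inv, a, b], [a, a])})"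

section \<open>The commuting graph\<close>

definition center :: "('a, 'm) monoid_scheme \<Rightarrow> 'a set" where
  "center G = {z \<in> carrier G. \<forall>x \<in> carrier G. z \<otimes>\<^bsub>G\<^esub> x = x \<otimes>\<^bsub>G\<^esub> z}"

text \<open>An undirected edge is represented by its two orientations, as in \<^locale>\<open>pair_graph\<close>.\<close>

definition commuting_graph :: "('a, 'm) monoid_scheme \<Rightarrow> 'a pair_pre_digraph" where
  "commuting_graph G = \<lparr>
     pverts = carrier G - center G,
     parcs = {(x, y). x \<in> carrier G - center G \<and> y \<in> carrier G - center G \<and>
                x \<noteq> y \<and> x \<otimes>\<^bsub>G\<^esub> y = y \<otimes>\<^bsub>G\<^esub> x}\<rparr>"

section \<open>Laplacian and signless Laplacian spectra\<close>

text \<open>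
  The list \<open>vs\<close> enumerates the vertices. In a symmetric digraph the out-degree of a vertex is its
  degree in the corresponding undirected graph.
\<close>

definition adjacency_mat :: "'a pair_pre_digraph \<Rightarrow> 'a list \<Rightarrow> complex mat" where
  "adjacency_mat \<Gamma> vs =
     mat (length vs) (length vs) (\<lambda>(i, j). if (vs ! i, vs ! j) \<in> parcs \<Gamma> then 1 else 0)"

definition degree_mat :: "'a pair_pre_digraph \<Rightarrow> 'a list \<Rightarrow> complex mat" where
  "degree_mat \<Gamma> vs =
     mat (length vs) (length vs)
       (\<lambda>(i, j). if i = j then of_nat (out_degree (with_proj \<Gamma>) (vs ! i)) else 0)"

definition eigenvalues_mset :: "complex mat \<Rightarrow> complex multiset" where
  "eigenvalues_mset A = proots (char_poly A)"

definition vertex_enumeration :: "'a pair_pre_digraph \<Rightarrow> 'a list" where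
  "vertex_enumeration \<Gamma> = (SOME vs. distinct vs \<and> set vs = pverts \<Gamma>)"

text \<open>The spectra do not depend on the enumeration chosen; see \<open>L_spec_eq\<close> and \<open>Q_spec_eq\<close> below.\<close>

definition L_spec :: "'a pair_pre_digraph \<Rightarrow> complex multiset" where
  "L_spec \<Gamma> = (let vs = vertex_enumeration \<Gamma>
     in eigenvalues_mset (degree_mat \<Gamma> vs - adjacency_mat \<Gamma> vs))"

definition Q_spec :: "'a pair_pre_digraph \<Rightarrow> complex multiset" where
  "Q_spec \<Gamma> = (let vs = vertex_enumeration \<Gamma>
     in eigenvalues_mset (degree_mat \<Gamma> vs + adjacency_mat \<Gamma> vs))"

section \<open>Well-definedness\<close>

lemma word_eq_append:
  assumes "word_eq R u u'" "word_eq R v v'"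
  shows "word_eq R (u @ v) (u' @ v')"
proof -
  have l: "word_eq R (w @ u) (w @ u')" if "word_eq R u u'" for w u u'
    using that
  proof induction
    case (cancel u x s v) show ?case using word_eq.cancel[of R "w @ u" x s v] by simp
  next
    case (relation l r u v) then show ?case using word_eq.relation[of l r R "w @ u" v] by simp
  qed (auto intro: word_eq.intros)
  have r: "word_eq R (u @ w) (u' @ w)" if "word_eq R u u'" for w u u'
    using that
  proof induction
    case (cancel u x s v) show ?case using word_eq.cancel[of R u x s "v @ w"] by simp
  next
    case (relation l r u v) then show ?case using word_eq.relation[of l r R u "v @ w"] by simp
  qed (auto intro: word_eq.intros)
  show ?thesis using r[OF assms(1), of v] l[OF assms(2), of u'] by (rule word_eq.trans)
qed

lemma word_class_eq_iff: "word_class R u = word_class R v \<longleftrightarrow> word_eq R u v"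
  unfolding word_class_def by (auto intro: word_eq.intros)

lemma presented_group_mult:
  "word_class R u \<otimes>\<^bsub>presented_group R\<^esub> word_class R v = word_class R (u @ v)"
  unfolding presented_group_def word_class_def
  by (auto intro: word_eq_append word_eq.intros)

lemma word_eq_inverse:
  "word_eq R (map (\<lambda>(x, s). (x, \<not> s)) (rev u) @ u) []"
proof (induction u)
  case Nil show ?case by (simp add: word_eq.refl)
next
  case (Cons p u)
  obtain x s where p: "p = (x, s)" by (cases p)
  show ?case
    using word_eq.cancel[of R "map (\<lambda>(x, s). (x, \<not> s)) (rev u)" x "\<not> s" u] Cons
    by (auto simp: p intro: word_eq.trans)
qed

lemma group_presented_group: "group (presented_group R)"
proof (rule groupI)
  fix U assume "U \<in> carrier (presented_group R)"
  then obtain u where U: "U = word_class R u" by (auto simp: presented_group_def)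
  have one: "\<one>\<^bsub>presented_group R\<^esub> = word_class R []" by (simp add: presented_group_def)
  show "\<one>\<^bsub>presented_group R\<^esub> \<otimes>\<^bsub>presented_group R\<^esub> U = U"
    by (simp add: one U presented_group_mult)
  show "\<exists>V\<in>carrier (presented_group R). V \<otimes>\<^bsub>presented_group R\<^esub> U = \<one>\<^bsub>presented_group R\<^esub>"
    by (rule bexI[of _ "word_class R (map (\<lambda>(x, s). (x, \<not> s)) (rev u))"])
      (simp_all add: one U presented_group_mult word_class_eq_iff word_eq_inverse,
       simp add: presented_group_def)
next
  fix U V assume "U \<in> carrier (presented_group R)" "V \<in> carrier (presented_group R)"
  then obtain u v where "U = word_class R u" "V = word_class R v"
    by (auto simp: presented_group_def)
  then show "U \<otimes>\<^bsub>presented_group R\<^esub> V \<in> carrier (presented_group R)"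
    by (simp add: presented_group_mult) (simp add: presented_group_def)
next
  fix U V W assume "U \<in> carrier (presented_group R)" "V \<in> carrier (presented_group R)"
    "W \<in> carrier (presented_group R)"
  then obtain u v w where "U = word_class R u" "V = word_class R v" "W = word_class R w"
    by (auto simp: presented_group_def)
  then show "U \<otimes>\<^bsub>presented_group R\<^esub> V \<otimes>\<^bsub>presented_group R\<^esub> W =
      U \<otimes>\<^bsub>presented_group R\<^esub> (V \<otimes>\<^bsub>presented_group R\<^esub> W)"
    by (simp add: presented_group_mult)
qed (simp add: presented_group_def)

lemma pair_graph_commuting_graph:
  assumes "finite (carrier G)"
  shows "pair_graph (commuting_graph G)"
proof -
  have "finite (parcs (commuting_graph G))"
    by (rule finite_subset[of _ "carrier G \<times> carrier G"])
      (use assms in \<open>auto simp: commuting_graph_def\<close>)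
  then show ?thesis using assms
    by unfold_locales
      (auto simp: commuting_graph_def arcs_ends_def arc_to_ends_def symmetric_def intro!: symI)
qed

lemma char_poly_reindex:
  fixes f :: "'a \<Rightarrow> 'a \<Rightarrow> 'b :: idom"
  assumes "distinct vs" "distinct ws" "set vs = set ws"
  shows "char_poly (mat (length vs) (length vs) (\<lambda>(i, j). f (vs ! i) (vs ! j))) =
    char_poly (mat (length ws) (length ws) (\<lambda>(i, j). f (ws ! i) (ws ! j)))"
proof -
  define n where "n = length ws"
  have "mset vs = mset ws" using assms by (simp add: set_eq_iff_mset_eq_distinct)
  then obtain p where p: "p permutes {..<n}" and vs: "permute_list p ws = vs"
    unfolding n_def by (rule mset_eq_permutation)
  have len: "length vs = n" using vs by (auto simp: n_def)
  have p': "p permutes {0..<n}" using p by (simp add: atLeast0LessThan)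
  have pi: "p i < n" if "i < n" for i using permutes_in_image[OF p, of i] that by simp
  have pij: "p i = p j \<longleftrightarrow> i = j" for i j using permutes_inj[OF p] by (auto dest: injD)
  have nth: "vs ! i = ws ! p i" if "i < n" for i
    using permute_list_nth[OF p[unfolded n_def], of i] that vs n_def by simp
  define C where "C = char_poly_matrix (mat n n (\<lambda>(i, j). f (ws ! i) (ws ! j)))"
  define D where "D = mat n n (\<lambda>(i, j). C $$ (p i, j))"
  have C: "C \<in> carrier_mat n n" and D: "D \<in> carrier_mat n n" "D\<^sup>T \<in> carrier_mat n n"
    unfolding C_def D_def by simp_all
  have "char_poly_matrix (mat n n (\<lambda>(i, j). f (vs ! i) (vs ! j))) =
      (mat n n (\<lambda>(i, j). D\<^sup>T $$ (p i, j)))\<^sup>T"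
    by (rule eq_matI) (auto simp: char_poly_matrix_def C_def D_def pi pij nth)
  then have "char_poly (mat n n (\<lambda>(i, j). f (vs ! i) (vs ! j))) =
      det ((mat n n (\<lambda>(i, j). D\<^sup>T $$ (p i, j)))\<^sup>T)"
    by (simp add: char_poly_def)
  also have "\<dots> = det (mat n n (\<lambda>(i, j). D\<^sup>T $$ (p i, j)))"
    by (rule det_transpose[of _ n]) simp
  also have "\<dots> = signof p * det (D\<^sup>T)" by (rule det_permute_rows[OF D(2) p'])
  also have "det (D\<^sup>T) = det D" by (rule det_transpose[OF D(1)])
  also have "det D = signof p * det C" unfolding D_def by (rule det_permute_rows[OF C p'])
  also have "signof p * (signof p * det C) = det C"
    by (simp add: sign_def)
  finally show ?thesis by (simp add: len n_def[symmetric] C_def char_poly_def)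
qed

lemma vertex_enumeration:
  assumes "finite (pverts \<Gamma>)"
  shows "distinct (vertex_enumeration \<Gamma>)" "set (vertex_enumeration \<Gamma>) = pverts \<Gamma>"
  using someI_ex[of "\<lambda>vs. distinct vs \<and> set vs = pverts \<Gamma>"] finite_distinct_list[OF assms]
  unfolding vertex_enumeration_def by blast+

lemma degree_adjacency_mat:
  assumes "distinct vs"
  shows "degree_mat \<Gamma> vs - adjacency_mat \<Gamma> vs = mat (length vs) (length vs) (\<lambda>(i, j).
      (\<lambda>x y. (if x = y then of_nat (out_degree (with_proj \<Gamma>) x) else 0) -
        (if (x, y) \<in> parcs \<Gamma> then 1 else 0)) (vs ! i) (vs ! j))"
    and "degree_mat \<Gamma> vs + adjacency_mat \<Gamma> vs = mat (length vs) (length vs) (\<lambda>(i, j).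
      (\<lambda>x y. (if x = y then of_nat (out_degree (with_proj \<Gamma>) x) else 0) +
        (if (x, y) \<in> parcs \<Gamma> then 1 else 0)) (vs ! i) (vs ! j))"
  using assms unfolding degree_mat_def adjacency_mat_def
  by (auto intro!: eq_matI simp: nth_eq_iff_index_eq)

lemma L_spec_eq:
  assumes "distinct vs" "set vs = pverts \<Gamma>"
  shows "L_spec \<Gamma> = eigenvalues_mset (degree_mat \<Gamma> vs - adjacency_mat \<Gamma> vs)"
proof -
  have fin: "finite (pverts \<Gamma>)" using assms by (metis List.finite_set)
  show ?thesis unfolding L_spec_def Let_def eigenvalues_mset_def
    degree_adjacency_mat(1)[OF vertex_enumeration(1)[OF fin]] degree_adjacency_mat(1)[OF assms(1)]
    by (rule arg_cong[of _ _ proots], rule char_poly_reindex)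
      (simp_all add: vertex_enumeration[OF fin] assms)
qed

lemma Q_spec_eq:
  assumes "distinct vs" "set vs = pverts \<Gamma>"
  shows "Q_spec \<Gamma> = eigenvalues_mset (degree_mat \<Gamma> vs + adjacency_mat \<Gamma> vs)"
proof -
  have fin: "finite (pverts \<Gamma>)" using assms by (metis List.finite_set)
  show ?thesis unfolding Q_spec_def Let_def eigenvalues_mset_def
    degree_adjacency_mat(2)[OF vertex_enumeration(1)[OF fin]] degree_adjacency_mat(2)[OF assms(1)]
    by (rule arg_cong[of _ _ proots], rule char_poly_reindex)
      (simp_all add: vertex_enumeration[OF fin] assms)
qed

end

theory Submission
  imports Defs
begin

text \<open>
  The presented group is isomorphic to the group of the 20 affine permutations of the integers
  modulo 5: every word reduces to the form \<open>b\<^sup>j a\<^sup>i\<close> with \<open>j < 4\<close> and \<open>i < 5\<close>, and the action on five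
  points separates these forms. The nontrivial affine permutations split into the four translations
  and, for each of the five points, the three permutations fixing that point; two of them commute
  only if they lie in the same part, and each part together with the identity is a cyclic group.
  Elements of \<open>G\<close> that agree modulo the center with powers of one element commute, so the commuting
  graph of \<open>G\<close> is the disjoint union of one complete graph on \<open>4 z\<close> and five on \<open>3 z\<close> vertices.
  Each complete graph contributes the spectrum of a matrix \<open>a I + c J\<close>, where \<open>J\<close> is the all-ones
  matrix.
\<close>

section \<open>Spectra of disjoint unions of complete graphs\<close>

text \<open>Entries depend on the vertices and not on their positions, so concatenating vertex lists
  corresponds to forming block matrices.\<close>

definition fun_mat :: "('a \<Rightarrow> 'a \<Rightarrow> 'b) \<Rightarrow> 'a list \<Rightarrow> 'b mat" where
  "fun_mat f vs = mat (length vs) (length vs) (\<lambda>(i, j). f (vs ! i) (vs ! j))"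

text \<open>Take as basis the all-ones vector together with all unit vectors but the first. The
  all-ones vector is an eigenvector for \<open>a + of_nat n * c\<close>, and every other basis
  vector is sent to \<open>a\<close> times itself plus \<open>c\<close> times the all-ones vector,
  which gives the triangular matrix \<open>T\<close>.\<close>

lemma char_poly_scalar_plus_constant:
  fixes a c :: "'a :: idom"
  assumes "0 < n"
  shows "char_poly (mat n n (\<lambda>(i, j). if i = j then a + c else c)) =
    [:- (a + of_nat n * c), 1:] * [:- a, 1:] ^ (n - 1)"
proof -
  define A where "A = mat n n (\<lambda>(i, j). if i = j then a + c else c)"
  text \<open>Conjugation by \<open>P\<close>, with ones on the diagonal and in the first column, makes \<open>A\<close> triangular.\<close>
  define p :: "nat \<Rightarrow> nat \<Rightarrow> 'a"
    where "p i k = (if k = i then 1 else 0) + (if k = 0 then if i = 0 then 0 else 1 else 0)" for i k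
  \<comment> \<open>\<open>p\<close> adds entry 0 to every other entry of a vector; \<open>q\<close>
    subtracts it again, so \<open>Q\<close> inverts \<open>P\<close> without any division.\<close>
  define q :: "nat \<Rightarrow> nat \<Rightarrow> 'a"
    where "q i k = (if k = i then 1 else 0) - (if k = 0 then if i = 0 then 0 else 1 else 0)" for i k
  define P where "P = mat n n (\<lambda>(i, k). p i k)"
  define Q where "Q = mat n n (\<lambda>(i, k). q i k)"
  define T where "T = mat n n (\<lambda>(i, j).
    if i = j then if i = 0 then a + of_nat n * c else a else if i = 0 then c else 0)"
  have p_sum: "(\<Sum>k=0..<n. p i k * g k) = g i + (if i = 0 then 0 else g 0)" if "i < n" for i g
    unfolding p_def using that
    by (simp add: distrib_right if_distrib[of "\<lambda>x. x * _"] sum.distrib cong: if_cong)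
  have q_sum: "(\<Sum>k=0..<n. q i k * g k) = g i - (if i = 0 then 0 else g 0)" if "i < n" for i g
    unfolding q_def using that
    by (simp add: left_diff_distrib if_distrib[of "\<lambda>x. x * _"] sum_subtractf cong: if_cong)
  have sum_p: "(\<Sum>k=0..<n. (if i = k then a + c else c) * p k j) =
      (if j = 0 then a + of_nat n * c else if i = j then a + c else c)" if "i < n" "j < n" for i j
  proof -
    have "(if i = k then a + c else c) * p k j =
        (if j = 0 then (if i = k then a else 0) + c else if k = j then if i = j then a + c else c else 0)" for k
      by (auto simp: p_def)
    then show ?thesis using that by (simp add: sum.distrib)
  qed
  have carr: "{A, T, P, Q} \<subseteq> carrier_mat n n"
    by (simp add: A_def T_def P_def Q_def)
  then have car: "A \<in> carrier_mat n n" "T \<in> carrier_mat n n" "P \<in> carrier_mat n n"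
      "Q \<in> carrier_mat n n"
    by simp_all
  have PQ: "P * Q = 1\<^sub>m n"
    unfolding P_def Q_def using assms
    by (intro eq_matI) (auto simp: scalar_prod_def p_sum, auto simp: q_def)
  have QP: "Q * P = 1\<^sub>m n"
    unfolding P_def Q_def using assms
    by (intro eq_matI) (auto simp: scalar_prod_def q_sum, auto simp: p_def)
  have "A * P = P * T"
    unfolding A_def P_def T_def using assms
    by (intro eq_matI) (auto simp: scalar_prod_def p_sum sum_p)
  then have "P * T * Q = A * (P * Q)"
    using assoc_mult_mat[OF car(1,3,4)] by simp
  then have "A = P * T * Q" using car by (simp add: PQ)
  then have "similar_mat A T"
    using similar_matI[OF carr PQ QP] by simp
  then have "char_poly A = char_poly T" by (rule char_poly_similar)
  also have "\<dots> = (\<Prod>a\<leftarrow>diag_mat T. [:- a, 1:])"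
    by (rule char_poly_upper_triangular) (auto simp: T_def)
  also have "diag_mat T = (a + of_nat n * c) # replicate (n - 1) a"
    by (rule nth_equalityI) (use assms in \<open>auto simp: diag_mat_def T_def nth_Cons split: nat.split\<close>)
  finally show ?thesis by (simp add: A_def)
qed

text \<open>The hypothesis kills the lower left block, so the characteristic matrix is block upper
  triangular and its determinant is the product over the diagonal blocks.\<close>

lemma char_poly_fun_mat_append:
  fixes f :: "'a \<Rightarrow> 'a \<Rightarrow> 'b :: idom"
  assumes "\<And>x y. x \<in> set vs \<Longrightarrow> y \<in> set ws \<Longrightarrow> f y x = 0"
  shows "char_poly (fun_mat f (vs @ ws)) = char_poly (fun_mat f vs) * char_poly (fun_mat f ws)"
proof -
  let ?n = "length vs" and ?m = "length ws"
  have "char_poly_matrix (fun_mat f (vs @ ws)) = four_block_mat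
      (char_poly_matrix (fun_mat f vs)) (mat ?n ?m (\<lambda>(i, j). [:- f (vs ! i) (ws ! j):]))
      (0\<^sub>m ?m ?n) (char_poly_matrix (fun_mat f ws))"
    using assms by (auto intro!: eq_matI simp: char_poly_matrix_def fun_mat_def nth_append)
  moreover have "det \<dots> = det (char_poly_matrix (fun_mat f vs)) * det (char_poly_matrix (fun_mat f ws))"
    by (rule det_four_block_mat_lower_left_zero[of _ ?n _ ?m])
      (auto simp: fun_mat_def)
  ultimately show ?thesis by (simp add: char_poly_def)
qed

lemma eigenvalues_mset_fun_mat_concat:
  assumes "sorted_wrt (\<lambda>vs ws. \<forall>x\<in>set vs. \<forall>y\<in>set ws. f y x = 0) vss"
  shows "eigenvalues_mset (fun_mat f (concat vss)) = (\<Sum>vs\<leftarrow>vss. eigenvalues_mset (fun_mat f vs))"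
  using assms
proof (induction vss)
  case Nil
  show ?case by (simp add: fun_mat_def char_poly_def char_poly_matrix_def eigenvalues_mset_def)
next
  case (Cons vs vss)
  \<comment> \<open>Root multisets add up over products of nonzero polynomials; a characteristic
    polynomial is nonzero because it is monic.\<close>
  have nz: "char_poly (fun_mat f ws) \<noteq> 0" for ws
    using degree_monic_char_poly[of "fun_mat f ws" "length ws"] by (auto simp: fun_mat_def)
  from Cons.prems have "char_poly (fun_mat f (vs @ concat vss)) =
      char_poly (fun_mat f vs) * char_poly (fun_mat f (concat vss))"
    by (intro char_poly_fun_mat_append) auto
  with Cons show ?case by (simp add: eigenvalues_mset_def proots_mult nz)
qed

lemma eigenvalues_mset_scalar_plus_constant:
  assumes "distinct vs" "vs \<noteq> []"
    and "\<And>x y. x \<in> set vs \<Longrightarrow> y \<in> set vs \<Longrightarrow> f x y = (if x = y then a + c else c)"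
  shows "eigenvalues_mset (fun_mat f vs) =
    add_mset (a + of_nat (length vs) * c) (replicate_mset (length vs - 1) a)"
proof -
  let ?n = "length vs"
  have "fun_mat f vs = mat ?n ?n (\<lambda>(i, j). if i = j then a + c else c)"
    using assms by (auto intro!: eq_matI simp: fun_mat_def nth_eq_iff_index_eq)
  then have "char_poly (fun_mat f vs) = [:- (a + of_nat ?n * c), 1:] * [:- a, 1:] ^ (?n - 1)"
    using assms by (simp only: char_poly_scalar_plus_constant length_greater_0_conv not_False_eq_True)
  moreover have "proots ([:- (a + of_nat ?n * c), 1:] * [:- a, 1:] ^ (?n - 1)) =
      proots [:- (a + of_nat ?n * c), 1:] + proots ([:- a, 1:] ^ (?n - 1))"
    by (rule proots_mult) auto
  ultimately show ?thesis
    by (simp add: eigenvalues_mset_def proots_power)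
qed

locale disjoint_union_of_cliques =
  fixes \<Gamma> :: "'a pair_pre_digraph" and C :: "nat \<Rightarrow> 'a set" and k :: nat
  assumes fin: "\<And>i. i < k \<Longrightarrow> finite (C i)"
    and nonempty: "\<And>i. i < k \<Longrightarrow> C i \<noteq> {}"
    and unique: "\<And>i j x. i < k \<Longrightarrow> j < k \<Longrightarrow> x \<in> C i \<Longrightarrow> x \<in> C j \<Longrightarrow> i = j"
    and verts: "pverts \<Gamma> = (\<Union>i<k. C i)"
    and arcs: "parcs \<Gamma> = {(x, y). x \<noteq> y \<and> (\<exists>i<k. x \<in> C i \<and> y \<in> C i)}"
begin

lemma out_degree_eq:
  assumes "i < k" "x \<in> C i"
  shows "out_degree (with_proj \<Gamma>) x = card (C i) - 1"
proof -
  have "out_arcs (with_proj \<Gamma>) x = Pair x ` (C i - {x})"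
    using assms by (auto simp: out_arcs_def arcs dest: unique)
  then show ?thesis
    using assms by (simp add: out_degree_def card_image inj_on_def)
qed

lemma mem_parcs_iff:
  assumes "i < k" "j < k" "x \<in> C i" "y \<in> C j"
  shows "(x, y) \<in> parcs \<Gamma> \<longleftrightarrow> x \<noteq> y \<and> i = j"
  using assms by (auto simp: arcs dest: unique)

text \<open>Enumerating the vertices clique by clique makes both Laplacians block diagonal.\<close>

definition vertex_lists :: "'a list list" where
  "vertex_lists = map (\<lambda>i. SOME vs. distinct vs \<and> set vs = C i) [0..<k]"

lemma length_vertex_lists: "length vertex_lists = k"
  by (simp add: vertex_lists_def)

lemma nth_vertex_lists:
  assumes "i < k"
  shows "distinct (vertex_lists ! i)" "set (vertex_lists ! i) = C i"
    "length (vertex_lists ! i) = card (C i)"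
proof -
  show "distinct (vertex_lists ! i)" "set (vertex_lists ! i) = C i"
    using someI_ex[of "\<lambda>vs. distinct vs \<and> set vs = C i"] finite_distinct_list[OF fin[OF assms]]
      assms by (auto simp: vertex_lists_def)
  then show "length (vertex_lists ! i) = card (C i)"
    using distinct_card by force
qed

lemma vertex_lists:
  "distinct (concat vertex_lists)" "set (concat vertex_lists) = pverts \<Gamma>"
proof -
  have "distinct vertex_lists"
    unfolding distinct_conv_nth length_vertex_lists
    using nth_vertex_lists(2) nonempty unique by (metis ex_in_conv)
  \<comment> \<open>\<open>distinct_concat_iff\<close> discards empty lists before it asks for
    distinctness; here there are none to discard.\<close>
  moreover have "removeAll [] vertex_lists = vertex_lists"
    using nth_vertex_lists(2) nonempty
    by (intro removeAll_id) (fastforce simp: in_set_conv_nth length_vertex_lists)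
  moreover have "set (vertex_lists ! i) \<inter> set (vertex_lists ! j) = {}"
    if "vertex_lists ! i \<noteq> vertex_lists ! j" "i < k" "j < k" for i j
    using that unique[of i j] by (auto simp: nth_vertex_lists)
  ultimately show "distinct (concat vertex_lists)"
    by (simp add: distinct_concat_iff) (metis in_set_conv_nth length_vertex_lists nth_vertex_lists(1))
  have "set vertex_lists = (\<lambda>i. vertex_lists ! i) ` {..<k}"
    by (auto simp: set_conv_nth length_vertex_lists)
  then show "set (concat vertex_lists) = pverts \<Gamma>"
    by (simp add: verts nth_vertex_lists(2))
qed

text \<open>The scalar part \<open>a i\<close> varies with the clique while \<open>c\<close> is
  common to all, which fits both Laplacians. Each clique gives one eigenvalue for its all-ones
  vector and \<open>card (C i) - 1\<close> others; an empty clique would falsely be credited with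
  the former.\<close>

lemma eigenvalues_mset_fun_mat:
  fixes f :: "'a \<Rightarrow> 'a \<Rightarrow> complex"
  assumes same: "\<And>i x y. i < k \<Longrightarrow> x \<in> C i \<Longrightarrow> y \<in> C i \<Longrightarrow> f x y = (if x = y then a i + c else c)"
    and diff: "\<And>i j x y. i < k \<Longrightarrow> j < k \<Longrightarrow> i \<noteq> j \<Longrightarrow> x \<in> C i \<Longrightarrow> y \<in> C j \<Longrightarrow> f x y = 0"
  shows "eigenvalues_mset (fun_mat f (concat vertex_lists)) =
    (\<Sum>i<k. add_mset (a i + of_nat (card (C i)) * c) (replicate_mset (card (C i) - 1) (a i)))"
proof -
  have "sorted_wrt (\<lambda>vs ws. \<forall>x\<in>set vs. \<forall>y\<in>set ws. f y x = 0) vertex_lists"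
    unfolding sorted_wrt_iff_nth_less length_vertex_lists
  proof (intro allI impI ballI)
    fix i j x y assume "i < j" "j < k" "x \<in> set (vertex_lists ! i)" "y \<in> set (vertex_lists ! j)"
    then show "f y x = 0" using diff[of j i y x] by (simp add: nth_vertex_lists)
  qed
  then have "eigenvalues_mset (fun_mat f (concat vertex_lists)) =
      (\<Sum>vs\<leftarrow>vertex_lists. eigenvalues_mset (fun_mat f vs))"
    by (rule eigenvalues_mset_fun_mat_concat)
  also have "\<dots> = (\<Sum>i<k. eigenvalues_mset (fun_mat f (vertex_lists ! i)))"
    by (simp add: sum_list_sum_nth length_vertex_lists atLeast0LessThan)
  also have "\<dots> = (\<Sum>i<k. add_mset (a i + of_nat (card (C i)) * c) (replicate_mset (card (C i) - 1) (a i)))"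
  proof (rule sum.cong)
    fix i assume "i \<in> {..<k}"
    then have i: "i < k" by simp
    have "vertex_lists ! i \<noteq> []" using nth_vertex_lists(2)[OF i] nonempty[OF i] by auto
    then show "eigenvalues_mset (fun_mat f (vertex_lists ! i)) =
        add_mset (a i + of_nat (card (C i)) * c) (replicate_mset (card (C i) - 1) (a i))"
      using eigenvalues_mset_scalar_plus_constant[of "vertex_lists ! i" f "a i" c]
        nth_vertex_lists[OF i] same[OF i] by simp
  qed simp
  finally show ?thesis .
qed

text \<open>On a clique with \<open>m\<close> vertices the diagonal entry is \<open>m - 1\<close>
  and the others are \<open>-1\<close>. Hence \<open>c = -1\<close> and \<open>a = m\<close>, and
  the all-ones vector has eigenvalue \<open>a + m * c = 0\<close>. Positivity of \<open>m\<close>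
  makes the truncated \<open>m - 1\<close> agree with the complex difference.\<close>

theorem L_spec:
  "L_spec \<Gamma> = (\<Sum>i<k. add_mset 0 (replicate_mset (card (C i) - 1) (of_nat (card (C i)))))"
proof -
  have pos: "card (C i) > 0" if "i < k" for i
    using that fin nonempty by (simp add: card_gt_0_iff)
  have eq: "degree_mat \<Gamma> (concat vertex_lists) - adjacency_mat \<Gamma> (concat vertex_lists) =
      fun_mat (\<lambda>x y. (if x = y then of_nat (out_degree (with_proj \<Gamma>) x) else 0) -
        (if (x, y) \<in> parcs \<Gamma> then 1 else 0)) (concat vertex_lists)"
    unfolding fun_mat_def degree_adjacency_mat(1)[OF vertex_lists(1)] by simp
  show ?thesis
    unfolding L_spec_eq[OF vertex_lists] eq
    by (subst eigenvalues_mset_fun_mat[where a = "\<lambda>i. of_nat (card (C i))" and c = "-1"])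
      (use pos unique in \<open>auto simp: out_degree_eq mem_parcs_iff of_nat_diff Suc_leI\<close>)
qed

text \<open>Now the off-diagonal entry is \<open>c = 1\<close>, so the diagonal \<open>m - 1\<close>
  forces \<open>a = m - 2\<close>, and the all-ones vector has eigenvalue
  \<open>a + m * c = 2 * m - 2\<close>.\<close>

theorem Q_spec:
  "Q_spec \<Gamma> = (\<Sum>i<k. add_mset (2 * of_nat (card (C i)) - 2)
    (replicate_mset (card (C i) - 1) (of_nat (card (C i)) - 2)))"
proof -
  have pos: "card (C i) > 0" if "i < k" for i
    using that fin nonempty by (simp add: card_gt_0_iff)
  have eq: "degree_mat \<Gamma> (concat vertex_lists) + adjacency_mat \<Gamma> (concat vertex_lists) =
      fun_mat (\<lambda>x y. (if x = y then of_nat (out_degree (with_proj \<Gamma>) x) else 0) +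
        (if (x, y) \<in> parcs \<Gamma> then 1 else 0)) (concat vertex_lists)"
    unfolding fun_mat_def degree_adjacency_mat(2)[OF vertex_lists(1)] by simp
  show ?thesis
    unfolding Q_spec_eq[OF vertex_lists] eq
    by (subst eigenvalues_mset_fun_mat[where a = "\<lambda>i. of_nat (card (C i)) - 2" and c = 1])
      (use pos unique in \<open>auto simp: out_degree_eq mem_parcs_iff of_nat_diff Suc_leI\<close>)
qed

end

section \<open>The presented group as an affine group\<close>

text \<open>
  The pair \<open>(s, i)\<close> stands for the permutation \<open>x \<mapsto> s * x + i\<close> of the integers modulo 5. The
  product applies its left factor first, as the relation \<open>b\<inverse> a b = a\<^sup>2\<close> requires.
\<close>

fun aff_mult :: "nat \<times> nat \<Rightarrow> nat \<times> nat \<Rightarrow> nat \<times> nat" where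
  "aff_mult (s, i) (t, k) = ((s * t) mod 5, (i * t + k) mod 5)"

definition aff :: "(nat \<times> nat) monoid" where
  "aff = \<lparr>carrier = {1..<5} \<times> {0..<5}, monoid.mult = aff_mult, one = (1, 0)\<rparr>"

lemma aff_sel [simp]:
  "carrier aff = {1..<5} \<times> {0..<5}" "monoid.mult aff = aff_mult" "\<one>\<^bsub>aff\<^esub> = (1, 0)"
  by (simp_all add: aff_def)

lemma aff_mult_assoc: "aff_mult (aff_mult p q) r = aff_mult p (aff_mult q r)"
proof -
  obtain s i t k u m where [simp]: "p = (s, i)" "q = (t, k)" "r = (u, m)" by (metis surj_pair)
  have "((i * t + k) mod 5 * u + m) mod 5 = ((i * t + k) * u + m) mod 5"
    by (intro mod_add_cong mod_mult_cong) simp_all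
  moreover have "(i * (t * u mod 5) + (k * u + m) mod 5) mod 5 = (i * (t * u) + (k * u + m)) mod 5"
    by (intro mod_add_cong mod_mult_cong) simp_all
  ultimately show ?thesis by (simp add: mod_simps algebra_simps)
qed

lemma aff_mult_one [simplified, simp]: "p \<in> carrier aff \<Longrightarrow> aff_mult (1, 0) p = p"
  by (cases p) auto

text \<open>The generator \<open>a\<close> acts as translation by 1 and \<open>b\<close> as
  doubling; modulo 5, 4 is the negative of 1 and 3 is the inverse of 2.\<close>

fun letter :: "sz_gen \<times> bool \<Rightarrow> nat \<times> nat" where
  "letter (gen_a, True) = (1, 1)"
| "letter (gen_a, False) = (1, 4)"
| "letter (gen_b, True) = (2, 0)"
| "letter (gen_b, False) = (3, 0)"

definition aff_val :: "sz_gen word \<Rightarrow> nat \<times> nat" where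
  "aff_val w = foldr (\<lambda>l p. aff_mult (letter l) p) w (1, 0)"

lemma aff_val_Nil [simp]: "aff_val [] = (1, 0)"
  and aff_val_Cons [simp]: "aff_val (l # w) = aff_mult (letter l) (aff_val w)"
  by (simp_all add: aff_val_def)

lemma aff_val_closed: "aff_val w \<in> carrier aff"
proof (induction w)
  case (Cons l w)
  obtain s i where p: "aff_val w = (s, i)" by fastforce
  have "s \<in> {1, 2, 3, 4}" using Cons p by auto
  then show ?case by (cases l rule: letter.cases) (auto simp: p)
qed simp

lemma aff_val_append: "aff_val (u @ v) = aff_mult (aff_val u) (aff_val v)"
  using aff_val_closed[of v] by (induction u) (simp_all add: aff_mult_assoc)

definition sz_rels :: "(sz_gen word \<times> sz_gen word) set" where "sz_rels =
  {([(gen_a, True), (gen_a, True), (gen_a, True), (gen_a, True), (gen_a, True)], []),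
   ([(gen_b, True), (gen_b, True), (gen_b, True), (gen_b, True)], []),
   ([(gen_b, False), (gen_a, True), (gen_b, True)], [(gen_a, True), (gen_a, True)])}"

lemma Sz2_eq: "Sz2 = presented_group sz_rels"
  by (simp add: Sz2_def sz_rels_def Let_def)

text \<open>Cancelling pairs evaluate to the identity and the three relations hold for the affine
  maps, so evaluation descends to word classes.\<close>

lemma word_eq_imp_aff_val_eq: "word_eq sz_rels u v \<Longrightarrow> aff_val u = aff_val v"
proof (induction rule: word_eq.induct)
  case (cancel u x s v)
  have "aff_val [(x, s), (x, \<not> s)] = (1, 0)"
    by (cases x; cases s) simp_all
  then show ?case using aff_val_closed[of v] aff_val_append[of "[(x, s), (x, \<not> s)]" v]
    by (simp add: aff_val_append)
next
  case (relation l r u v)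
  then have "aff_val l = aff_val r" by (auto simp: sz_rels_def)
  then show ?case by (simp add: aff_val_append)
qed simp_all

text \<open>The order of 2 modulo 5 is 4.\<close>

lemma inj_pow2_mod5:
  assumes "(2::nat) ^ j mod 5 = 2 ^ k mod 5" "j < 4" "k < 4"
  shows "j = k"
proof -
  have "\<forall>j\<in>set [0..<4]. \<forall>k\<in>set [0..<4]. (2::nat) ^ j mod 5 = 2 ^ k mod 5 \<longrightarrow> j = k"
    by code_simp
  with assms show ?thesis by simp
qed

text \<open>On a word class the image is a singleton, because evaluation is constant there.\<close>

definition sz_aff :: "sz_gen word set \<Rightarrow> nat \<times> nat" where
  "sz_aff U = the_elem (aff_val ` U)"

lemma sz_aff_word_class: "sz_aff (word_class sz_rels u) = aff_val u"
proof -
  have "aff_val ` word_class sz_rels u = {aff_val u}"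
    using word_eq_imp_aff_val_eq[of u] word_eq.refl[of sz_rels u]
    unfolding word_class_def by (metis (lifting) image_cong image_constant mem_Collect_eq)
  then show ?thesis by (simp add: sz_aff_def)
qed

lemma carrier_Sz2: "carrier Sz2 = range (word_class sz_rels)"
  by (simp add: Sz2_eq presented_group_def)

lemma word_class_closed [simp]: "word_class sz_rels u \<in> carrier Sz2"
  by (simp add: carrier_Sz2)

lemma sz_aff_hom: "sz_aff \<in> hom Sz2 aff"
proof (rule homI)
  fix U V assume "U \<in> carrier Sz2" "V \<in> carrier Sz2"
  then obtain u v where "U = word_class sz_rels u" "V = word_class sz_rels v"
    by (auto simp: carrier_Sz2)
  then show "sz_aff (U \<otimes>\<^bsub>Sz2\<^esub> V) = sz_aff U \<otimes>\<^bsub>aff\<^esub> sz_aff V"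
    by (simp add: Sz2_eq presented_group_mult sz_aff_word_class aff_val_append)
next
  fix U assume "U \<in> carrier Sz2"
  then obtain u where "U = word_class sz_rels u"
    by (auto simp: carrier_Sz2)
  then show "sz_aff U \<in> carrier aff" using aff_val_closed[of u] by (simp only: sz_aff_word_class)
qed

interpretation Sz2: group Sz2
  unfolding Sz2_eq by (rule group_presented_group)

section \<open>Normal forms in the presented group\<close>

definition sz_a where "sz_a = word_class sz_rels [(gen_a, True)]"
definition sz_b where "sz_b = word_class sz_rels [(gen_b, True)]"

lemma sz_closed [simp]: "sz_a \<in> carrier Sz2" "sz_b \<in> carrier Sz2"
  by (simp_all add: sz_a_def sz_b_def carrier_Sz2)

lemma sz_mult: "word_class sz_rels u \<otimes>\<^bsub>Sz2\<^esub> word_class sz_rels v = word_class sz_rels (u @ v)"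
  by (simp add: Sz2_eq presented_group_mult)

lemma sz_one: "\<one>\<^bsub>Sz2\<^esub> = word_class sz_rels []"
  by (simp add: Sz2_eq presented_group_def)

lemma sz_inv: "word_class sz_rels [(x, False)] = inv\<^bsub>Sz2\<^esub> (word_class sz_rels [(x, True)])"
  using word_eq.cancel[of sz_rels "[]" x False "[]"]
  by (intro Sz2.inv_equality[symmetric]) (simp_all add: sz_mult sz_one word_class_eq_iff)

lemma sz_a_pow: "sz_a [^]\<^bsub>Sz2\<^esub> n = word_class sz_rels (replicate n (gen_a, True))" for n :: nat
  by (induction n) (simp_all add: sz_one sz_a_def sz_mult replicate_append_same)

lemma sz_b_pow: "sz_b [^]\<^bsub>Sz2\<^esub> n = word_class sz_rels (replicate n (gen_b, True))" for n :: nat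
  by (induction n) (simp_all add: sz_one sz_b_def sz_mult replicate_append_same)

lemma word_class_relation: "(l, r) \<in> R \<Longrightarrow> word_class R l = word_class R r"
  using word_eq.relation[of l r R "[]" "[]"] by (simp add: word_class_eq_iff)

lemma sz_a_5: "sz_a [^]\<^bsub>Sz2\<^esub> (5::nat) = \<one>\<^bsub>Sz2\<^esub>"
  unfolding sz_a_pow sz_one by (rule word_class_relation) (simp add: sz_rels_def eval_nat_numeral)

lemma sz_b_4: "sz_b [^]\<^bsub>Sz2\<^esub> (4::nat) = \<one>\<^bsub>Sz2\<^esub>"
  unfolding sz_b_pow sz_one by (rule word_class_relation) (simp add: sz_rels_def eval_nat_numeral)

text \<open>The third relation, multiplied by \<open>b\<close> on the left, becomes a rule for
  moving \<open>b\<close> to the left of \<open>a\<close>. Every \<open>b\<close> that passes a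
  power of \<open>a\<close> doubles its exponent.\<close>

lemma sz_a_mult_b: "sz_a \<otimes>\<^bsub>Sz2\<^esub> sz_b = sz_b \<otimes>\<^bsub>Sz2\<^esub> sz_a [^]\<^bsub>Sz2\<^esub> (2::nat)"
proof -
  have "word_class sz_rels [(gen_b, False), (gen_a, True), (gen_b, True)] =
      sz_a [^]\<^bsub>Sz2\<^esub> (2::nat)"
    unfolding sz_a_pow by (rule word_class_relation) (simp add: sz_rels_def eval_nat_numeral)
  then have "sz_a [^]\<^bsub>Sz2\<^esub> (2::nat) = inv\<^bsub>Sz2\<^esub> sz_b \<otimes>\<^bsub>Sz2\<^esub> (sz_a \<otimes>\<^bsub>Sz2\<^esub> sz_b)"
    by (simp add: sz_a_def sz_b_def sz_inv[symmetric] sz_mult)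
  then show ?thesis by (simp add: Sz2.m_assoc[symmetric])
qed

lemma sz_a_pow_mult_b:
  "sz_a [^]\<^bsub>Sz2\<^esub> n \<otimes>\<^bsub>Sz2\<^esub> sz_b = sz_b \<otimes>\<^bsub>Sz2\<^esub> sz_a [^]\<^bsub>Sz2\<^esub> (2 * n)" for n :: nat
proof (induction n)
  case (Suc n)
  have "sz_a [^]\<^bsub>Sz2\<^esub> Suc n \<otimes>\<^bsub>Sz2\<^esub> sz_b = sz_a [^]\<^bsub>Sz2\<^esub> n \<otimes>\<^bsub>Sz2\<^esub> (sz_a \<otimes>\<^bsub>Sz2\<^esub> sz_b)"
    by (simp add: Sz2.m_assoc)
  also have "\<dots> = (sz_a [^]\<^bsub>Sz2\<^esub> n \<otimes>\<^bsub>Sz2\<^esub> sz_b) \<otimes>\<^bsub>Sz2\<^esub> sz_a [^]\<^bsub>Sz2\<^esub> (2::nat)"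
    by (simp add: Sz2.m_assoc sz_a_mult_b)
  also have "\<dots> = sz_b \<otimes>\<^bsub>Sz2\<^esub> sz_a [^]\<^bsub>Sz2\<^esub> (2 * n + 2)"
    by (simp only: Suc.IH) (simp add: Sz2.m_assoc Sz2.nat_pow_mult)
  finally show ?case by simp
qed simp

lemma sz_a_pow_mult_b_pow:
  "sz_a [^]\<^bsub>Sz2\<^esub> n \<otimes>\<^bsub>Sz2\<^esub> sz_b [^]\<^bsub>Sz2\<^esub> j = sz_b [^]\<^bsub>Sz2\<^esub> j \<otimes>\<^bsub>Sz2\<^esub> sz_a [^]\<^bsub>Sz2\<^esub> (2 ^ j * n)"
  for n j :: nat
proof (induction j)
  case (Suc j)
  have "sz_a [^]\<^bsub>Sz2\<^esub> n \<otimes>\<^bsub>Sz2\<^esub> sz_b [^]\<^bsub>Sz2\<^esub> Suc j =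
      (sz_a [^]\<^bsub>Sz2\<^esub> n \<otimes>\<^bsub>Sz2\<^esub> sz_b [^]\<^bsub>Sz2\<^esub> j) \<otimes>\<^bsub>Sz2\<^esub> sz_b"
    by (simp add: Sz2.m_assoc)
  also have "\<dots> = sz_b [^]\<^bsub>Sz2\<^esub> j \<otimes>\<^bsub>Sz2\<^esub> (sz_a [^]\<^bsub>Sz2\<^esub> (2 ^ j * n) \<otimes>\<^bsub>Sz2\<^esub> sz_b)"
    by (simp only: Suc.IH) (simp add: Sz2.m_assoc)
  also have "\<dots> = sz_b [^]\<^bsub>Sz2\<^esub> Suc j \<otimes>\<^bsub>Sz2\<^esub> sz_a [^]\<^bsub>Sz2\<^esub> (2 ^ Suc j * n)"
    by (simp add: Sz2.m_assoc sz_a_pow_mult_b mult.assoc)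
  finally show ?case .
qed simp

lemma pow_mod:
  fixes H (structure)
  assumes "group H" "x \<in> carrier H" "x [^] m = \<one>"
  shows "x [^] (n mod m) = x [^] (n :: nat)"
proof -
  interpret group H by fact
  have "x [^] n = x [^] (m * (n div m) + n mod m)" by simp
  also have "\<dots> = x [^] (n mod m)"
    unfolding nat_pow_mult[OF assms(2), symmetric] nat_pow_pow[OF assms(2), symmetric]
    using assms by simp
  finally show ?thesis by simp
qed

text \<open>Induction on words: a letter put in front is a power of \<open>a\<close> or
  \<open>b\<close>; a power of \<open>a\<close> is moved across the powers of \<open>b\<close> and
  absorbed on the right. The exponents are reduced modulo the orders only at the end.\<close>

lemma sz_normal_form:
  assumes "U \<in> carrier Sz2"
  obtains j i :: nat where "j < 4" "i < 5" "U = sz_b [^]\<^bsub>Sz2\<^esub> j \<otimes>\<^bsub>Sz2\<^esub> sz_a [^]\<^bsub>Sz2\<^esub> i"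
proof -
  \<comment> \<open>Inverse letters are nonnegative powers as well: the inverse of \<open>a\<close>
    is its fourth power, and that of \<open>b\<close> its third.\<close>
  have a: "\<exists>n::nat. word_class sz_rels [(gen_a, s)] = sz_a [^]\<^bsub>Sz2\<^esub> n" for s
  proof (cases s)
    case True
    then show ?thesis by (intro exI[of _ 1]) (simp add: sz_a_def)
  next
    case False
    have "sz_a [^]\<^bsub>Sz2\<^esub> (4::nat) \<otimes>\<^bsub>Sz2\<^esub> sz_a = \<one>\<^bsub>Sz2\<^esub>"
      using sz_a_5 by (simp add: numeral_eq_Suc)
    then show ?thesis using False
      by (intro exI[of _ 4]) (simp add: sz_inv sz_a_def[symmetric] Sz2.inv_equality)
  qed
  have b: "\<exists>n::nat. word_class sz_rels [(gen_b, s)] = sz_b [^]\<^bsub>Sz2\<^esub> n" for s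
  proof (cases s)
    case True
    then show ?thesis by (intro exI[of _ 1]) (simp add: sz_b_def)
  next
    case False
    have "sz_b [^]\<^bsub>Sz2\<^esub> (3::nat) \<otimes>\<^bsub>Sz2\<^esub> sz_b = \<one>\<^bsub>Sz2\<^esub>"
      using sz_b_4 by (simp add: numeral_eq_Suc)
    then show ?thesis using False
      by (intro exI[of _ 3]) (simp add: sz_inv sz_b_def[symmetric] Sz2.inv_equality)
  qed
  have nf: "\<exists>(j::nat) (i::nat). word_class sz_rels w = sz_b [^]\<^bsub>Sz2\<^esub> j \<otimes>\<^bsub>Sz2\<^esub> sz_a [^]\<^bsub>Sz2\<^esub> i" for w
  proof (induction w)
    case Nil
    show ?case by (rule exI[of _ 0], rule exI[of _ 0]) (simp add: sz_one[symmetric])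
  next
    case (Cons l w)
    then obtain j i :: nat
      where w: "word_class sz_rels w = sz_b [^]\<^bsub>Sz2\<^esub> j \<otimes>\<^bsub>Sz2\<^esub> sz_a [^]\<^bsub>Sz2\<^esub> i"
      by blast
    have lw: "word_class sz_rels (l # w) =
        word_class sz_rels [l] \<otimes>\<^bsub>Sz2\<^esub> (sz_b [^]\<^bsub>Sz2\<^esub> j \<otimes>\<^bsub>Sz2\<^esub> sz_a [^]\<^bsub>Sz2\<^esub> i)"
      using sz_mult[of "[l]" w] by (simp add: w)
    obtain x s where l: "l = (x, s)" by fastforce
    show ?case
    proof (cases x)
      case gen_a
      obtain n :: nat where n: "word_class sz_rels [l] = sz_a [^]\<^bsub>Sz2\<^esub> n"
        using a[of s] unfolding l gen_a by (elim exE)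
      have "word_class sz_rels (l # w) =
          (sz_a [^]\<^bsub>Sz2\<^esub> n \<otimes>\<^bsub>Sz2\<^esub> sz_b [^]\<^bsub>Sz2\<^esub> j) \<otimes>\<^bsub>Sz2\<^esub> sz_a [^]\<^bsub>Sz2\<^esub> i"
        unfolding lw n by (simp add: Sz2.m_assoc)
      also have "\<dots> = sz_b [^]\<^bsub>Sz2\<^esub> j \<otimes>\<^bsub>Sz2\<^esub> sz_a [^]\<^bsub>Sz2\<^esub> (2 ^ j * n + i)"
        unfolding sz_a_pow_mult_b_pow by (simp add: Sz2.m_assoc Sz2.nat_pow_mult)
      finally show ?thesis by (intro exI)
    next
      case gen_b
      obtain n :: nat where n: "word_class sz_rels [l] = sz_b [^]\<^bsub>Sz2\<^esub> n"
        using b[of s] unfolding l gen_b by (elim exE)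
      have "word_class sz_rels (l # w) =
          sz_b [^]\<^bsub>Sz2\<^esub> (n + j) \<otimes>\<^bsub>Sz2\<^esub> sz_a [^]\<^bsub>Sz2\<^esub> i"
        unfolding lw n by (simp add: Sz2.m_assoc flip: Sz2.nat_pow_mult)
      then show ?thesis by (intro exI)
    qed
  qed
  obtain j i :: nat where "U = sz_b [^]\<^bsub>Sz2\<^esub> j \<otimes>\<^bsub>Sz2\<^esub> sz_a [^]\<^bsub>Sz2\<^esub> i"
    using nf assms unfolding carrier_Sz2 by blast
  then have "U = sz_b [^]\<^bsub>Sz2\<^esub> (j mod 4) \<otimes>\<^bsub>Sz2\<^esub> sz_a [^]\<^bsub>Sz2\<^esub> (i mod 5)"
    by (simp only: pow_mod[OF Sz2.is_group] sz_a_5 sz_b_4 sz_closed)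
  then show thesis by (intro that[of "j mod 4" "i mod 5"]) simp_all
qed

lemma aff_val_normal_form:
  "aff_val (replicate j (gen_b, True) @ replicate i (gen_a, True)) = (2 ^ j mod 5, i mod 5)"
proof -
  have "aff_val (replicate i (gen_a, True)) = (1, i mod 5)"
    by (induction i) (simp_all add: mod_simps)
  moreover have "aff_val (replicate j (gen_b, True)) = (2 ^ j mod 5, 0)"
    by (induction j) (simp_all add: mod_simps)
  ultimately show ?thesis by (simp add: aff_val_append)
qed

lemma sz_aff_normal_form:
  "sz_aff (sz_b [^]\<^bsub>Sz2\<^esub> j \<otimes>\<^bsub>Sz2\<^esub> sz_a [^]\<^bsub>Sz2\<^esub> i) = (2 ^ j mod 5, i mod 5)" for i j :: nat
  unfolding sz_a_pow sz_b_pow sz_mult sz_aff_word_class by (rule aff_val_normal_form)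

text \<open>A normal form can be read off its affine value: the multiplier determines
  \<open>j < 4\<close> and the translation part determines \<open>i < 5\<close>. This gives
  injectivity; surjectivity holds because 2 generates the nonzero residues.\<close>

lemma sz_aff_iso: "sz_aff \<in> iso Sz2 aff"
proof (rule isoI[OF sz_aff_hom], rule bij_betw_imageI)
  show "inj_on sz_aff (carrier Sz2)"
  proof (rule inj_onI)
    fix U V assume U: "U \<in> carrier Sz2" and V: "V \<in> carrier Sz2" and eq: "sz_aff U = sz_aff V"
    obtain j i :: nat where 1: "j < 4" "i < 5" "U = sz_b [^]\<^bsub>Sz2\<^esub> j \<otimes>\<^bsub>Sz2\<^esub> sz_a [^]\<^bsub>Sz2\<^esub> i"
      using U by (rule sz_normal_form)
    obtain l k :: nat where 2: "l < 4" "k < 5" "V = sz_b [^]\<^bsub>Sz2\<^esub> l \<otimes>\<^bsub>Sz2\<^esub> sz_a [^]\<^bsub>Sz2\<^esub> k"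
      using V by (rule sz_normal_form)
    have "sz_aff U = (2 ^ j mod 5, i mod 5)" "sz_aff V = (2 ^ l mod 5, k mod 5)"
      unfolding 1(3) 2(3) by (rule sz_aff_normal_form)+
    then have "2 ^ j mod 5 = (2 ^ l mod 5 :: nat)" "i mod 5 = k mod 5" using eq by simp_all
    then have "j = l" "i = k" using inj_pow2_mod5[of j l] 1(1,2) 2(1,2) by simp_all
    then show "U = V" using 1 2 by simp
  qed
  show "sz_aff ` carrier Sz2 = carrier aff"
  proof
    show "sz_aff ` carrier Sz2 \<subseteq> carrier aff"
      by (rule hom_carrier[OF sz_aff_hom])
    show "carrier aff \<subseteq> sz_aff ` carrier Sz2"
    proof
      fix p assume "p \<in> carrier aff"
      then obtain s i where p: "p = (s, i)" "s \<in> {1, 2, 3, 4}" "i < 5" by force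
      \<comment> \<open>The exponents 0, 1, 2, 3 give the residues 1, 2, 4, 3.\<close>
      then have "\<exists>j::nat. s = 2 ^ j mod 5"
        using exI[of "\<lambda>j. s = 2 ^ j mod 5" 0] exI[of "\<lambda>j. s = 2 ^ j mod 5" 1]
          exI[of "\<lambda>j. s = 2 ^ j mod 5" 2] exI[of "\<lambda>j. s = 2 ^ j mod 5" 3] by auto
      then obtain j :: nat where "s = 2 ^ j mod 5" by blast
      then have "p = sz_aff (sz_b [^]\<^bsub>Sz2\<^esub> j \<otimes>\<^bsub>Sz2\<^esub> sz_a [^]\<^bsub>Sz2\<^esub> i)"
        using p by (simp only: sz_aff_normal_form) simp
      then show "p \<in> sz_aff ` carrier Sz2" by auto
    qed
  qed
qed

section \<open>Partition of the nontrivial affine maps by commutation\<close>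

text \<open>
  Class \<open>5\<close> consists of the nontrivial translations; class \<open>c < 5\<close> consists of the nontrivial maps
  fixing the point \<open>c\<close>, since \<open>x \<mapsto> 2 * x + 4 * c\<close> generates their stabilizer.
\<close>

definition cyc_gen :: "nat \<Rightarrow> nat \<times> nat" where
  "cyc_gen c = (if c = 5 then (1, 1) else (2, 4 * c mod 5))"

text \<open>The generator has order 5 for class 5 and order 4 otherwise; starting at exponent 1
  leaves out the identity.\<close>

definition cyc_class :: "nat \<Rightarrow> (nat \<times> nat) list" where
  "cyc_class c = map (\<lambda>e. ((\<lambda>p. aff_mult p (cyc_gen c)) ^^ e) (1, 0)) [1..<if c = 5 then 5 else 4]"

text \<open>The list form lets statements about all 20 maps be decided by evaluation.\<close>

lemma carrier_aff_list: "carrier aff = set (List.product [1..<5] [0..<5])"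
  by (simp only: aff_sel set_product set_upt)

text \<open>A map with multiplier other than 1 has a unique fixed point modulo 5, hence lies in the
  class of that point; the remaining nontrivial maps are translations.\<close>

lemma cyc_class_cover:
  assumes "p \<in> carrier aff" "p \<noteq> (1, 0)"
  obtains c where "c < 6" "p \<in> set (cyc_class c)"
proof -
  have "\<forall>p\<in>set (List.product [1..<5] [0..<5]).
      p = (1, 0) \<or> (\<exists>c\<in>set [0..<6]. p \<in> set (cyc_class c))"
    by code_simp
  then have "\<exists>c\<in>set [0..<6]. p \<in> set (cyc_class c)"
    using assms unfolding carrier_aff_list by blast
  then show thesis using that by auto
qed

lemma cyc_class_distinct: "c < 6 \<Longrightarrow> distinct (cyc_class c)"
  and one_not_in_cyc_class: "c < 6 \<Longrightarrow> (1, 0) \<notin> set (cyc_class c)"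
  and cyc_class_closed: "c < 6 \<Longrightarrow> p \<in> set (cyc_class c) \<Longrightarrow> p \<in> carrier aff"
proof -
  have all: "\<forall>c\<in>set [0..<6]. distinct (cyc_class c) \<and> (1, 0) \<notin> set (cyc_class c) \<and>
      (\<forall>p\<in>set (cyc_class c). p \<in> set (List.product [1..<5] [0..<5]))"
    by code_simp
  have *: "distinct (cyc_class c) \<and> (1, 0) \<notin> set (cyc_class c) \<and>
      (\<forall>p\<in>set (cyc_class c). p \<in> carrier aff)" if "c < 6" for c
  proof -
    have "c \<in> set [0..<6]" using that by simp
    with all show ?thesis unfolding carrier_aff_list by blast
  qed
  show "distinct (cyc_class c)" "(1, 0) \<notin> set (cyc_class c)" if "c < 6"
    using *[OF that] by blast+
  show "p \<in> carrier aff" if "c < 6" "p \<in> set (cyc_class c)"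
    using *[OF that(1)] that(2) by blast
qed

text \<open>Commuting maps preserve each other's fixed-point sets. A nontrivial map has no fixed
  point if it is a translation and exactly one otherwise, so commuting nontrivial maps share a
  class.\<close>

lemma cyc_class_commute:
  assumes "c < 6" "d < 6" "p \<in> set (cyc_class c)" "q \<in> set (cyc_class d)"
    and "aff_mult p q = aff_mult q p"
  shows "c = d"
proof -
  have "\<forall>c\<in>set [0..<6]. \<forall>d\<in>set [0..<6]. \<forall>p\<in>set (cyc_class c). \<forall>q\<in>set (cyc_class d).
      c = d \<or> aff_mult p q \<noteq> aff_mult q p"
    by code_simp
  moreover have "c \<in> set [0..<6]" "d \<in> set [0..<6]" using assms by simp_all
  ultimately show ?thesis using assms(3-5) by blast
qed

text \<open>This identifies the image of the identity under a homomorphism into \<open>aff\<close>,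
  since that image is idempotent.\<close>

lemma aff_idem:
  assumes "p \<in> carrier aff" "aff_mult p p = p"
  shows "p = (1, 0)"
proof -
  have "\<forall>p\<in>set (List.product [1..<5] [0..<5]). aff_mult p p = p \<longrightarrow> p = (1, 0)"
    by code_simp
  then show ?thesis using assms unfolding carrier_aff_list by blast
qed

lemma length_cyc_class: "length (cyc_class c) = (if c = 5 then 4 else 3)"
  by (simp add: cyc_class_def)

lemma cyc_gen_closed: "cyc_gen c \<in> carrier aff"
  by (simp add: cyc_gen_def)

section \<open>Central extensions of the affine group\<close>

lemma (in group) center_normal: "center G \<lhd> G"
proof -
  have comm: "a \<in> carrier G" "\<And>x. x \<in> carrier G \<Longrightarrow> a \<otimes> x = x \<otimes> a" if "a \<in> center G" for a
    using that by (simp_all add: center_def)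
  have "subgroup (center G) G"
  proof (rule subgroupI)
    fix a assume a: "a \<in> center G"
    note ac = comm(1)[OF a]
    have "inv a \<otimes> x = x \<otimes> inv a" if x: "x \<in> carrier G" for x
    proof -
      have "inv a \<otimes> x = inv a \<otimes> (x \<otimes> a) \<otimes> inv a"
        using x ac by (simp add: m_assoc)
      also have "\<dots> = inv a \<otimes> (a \<otimes> x) \<otimes> inv a"
        by (simp only: comm(2)[OF a x])
      also have "\<dots> = x \<otimes> inv a"
        using x ac by (simp add: m_assoc[symmetric])
      finally show ?thesis .
    qed
    then show "inv a \<in> center G" using ac by (simp add: center_def)
  next
    fix a b assume a: "a \<in> center G" and b: "b \<in> center G"
    note ac = comm(1)[OF a] and bc = comm(1)[OF b]
    have "a \<otimes> b \<otimes> x = x \<otimes> (a \<otimes> b)" if x: "x \<in> carrier G" for x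
    proof -
      have "a \<otimes> b \<otimes> x = a \<otimes> (b \<otimes> x)" using x ac bc by (simp add: m_assoc)
      also have "\<dots> = a \<otimes> x \<otimes> b" using x ac bc by (simp only: comm(2)[OF b x] m_assoc)
      also have "\<dots> = x \<otimes> (a \<otimes> b)" using x ac bc by (simp only: comm(2)[OF a x] m_assoc)
      finally show ?thesis .
    qed
    then show "a \<otimes> b \<in> center G" using ac bc by (simp add: center_def)
  qed (auto simp: center_def)
  moreover have "x \<otimes> h \<otimes> inv x \<in> center G" if x: "x \<in> carrier G" and h: "h \<in> center G" for x h
  proof -
    have "x \<otimes> h \<otimes> inv x = h"
      using x comm(1)[OF h] by (simp add: m_assoc flip: comm(2)[OF h x])
    then show ?thesis using h by simp
  qed
  ultimately show ?thesis by (simp add: normal_inv_iff)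
qed

text \<open>Here \<phi> stands for the quotient map by the center followed by an isomorphism onto
  \<open>aff\<close>, so that arguments can use elements of \<open>G\<close> instead of
  cosets.\<close>

locale central_quotient_aff = group G for G (structure) +
  fixes \<phi> :: "'a \<Rightarrow> nat \<times> nat"
  assumes finite_carrier: "finite (carrier G)"
    and hom: "\<phi> \<in> hom G aff"
    and surj: "\<phi> ` carrier G = carrier aff"
    and eq_iff: "\<And>x y. x \<in> carrier G \<Longrightarrow> y \<in> carrier G \<Longrightarrow>
      \<phi> x = \<phi> y \<longleftrightarrow> center G #> x = center G #> y"
begin

lemma subgroup_center: "subgroup (center G) G"
  using center_normal by (rule normal_imp_subgroup)

lemma \<phi>_mult: "x \<in> carrier G \<Longrightarrow> y \<in> carrier G \<Longrightarrow> \<phi> (x \<otimes> y) = aff_mult (\<phi> x) (\<phi> y)"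
  using hom_mult[OF hom] by simp

lemma \<phi>_one: "\<phi> \<one> = (1, 0)"
  using \<phi>_mult[of \<one> \<one>] surj by (intro aff_idem) auto

lemma mem_center_iff:
  assumes "x \<in> carrier G"
  shows "x \<in> center G \<longleftrightarrow> \<phi> x = (1, 0)"
proof -
  have "x \<in> center G \<longleftrightarrow> center G #> x = center G"
    using coset_join1[OF _ assms subgroup_center] coset_join2[OF assms subgroup_center] by blast
  moreover have "center G #> \<one> = center G"
    by (rule coset_join2[OF one_closed subgroup_center subgroup.one_closed[OF subgroup_center]])
  ultimately show ?thesis using eq_iff[OF assms one_closed] by (simp only: \<phi>_one)
qed

text \<open>The iterated right multiplication matches the form of the entries of
  \<open>cyc_class\<close>.\<close>

lemma \<phi>_pow:
  fixes n :: nat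
  assumes "x \<in> carrier G"
  shows "\<phi> (x [^] n) = ((\<lambda>p. aff_mult p (\<phi> x)) ^^ n) (1, 0)"
proof (induction n)
  case 0
  show ?case using \<phi>_one by simp
next
  case (Suc n)
  have "\<phi> (x [^] Suc n) = aff_mult (\<phi> (x [^] n)) (\<phi> x)"
    using \<phi>_mult[of "x [^] n" x] assms by simp
  then show ?case by (simp only: Suc.IH funpow.simps o_apply)
qed

definition C :: "nat \<Rightarrow> 'a set" where
  "C c = {x \<in> carrier G. \<phi> x \<in> set (cyc_class c)}"

text \<open>Modulo the center, all elements of a class are powers of one element.\<close>

lemma commute_same_class:
  assumes "x \<in> C c" "y \<in> C c"
  shows "x \<otimes> y = y \<otimes> x"
proof -
  obtain g where g: "g \<in> carrier G" "\<phi> g = cyc_gen c"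
    using cyc_gen_closed[of c] unfolding surj[symmetric] by auto
  \<comment> \<open>Equal values under \<phi> mean equal cosets of the center, so \<open>w\<close>
    differs from a power of \<open>g\<close> by a central factor.\<close>
  have dec: "\<exists>z\<in>center G. \<exists>n::nat. w = z \<otimes> g [^] n" if w: "w \<in> C c" for w
  proof -
    obtain n where "\<phi> w = ((\<lambda>p. aff_mult p (cyc_gen c)) ^^ n) (1, 0)"
      using w unfolding C_def cyc_class_def set_map by blast
    then have "\<phi> (g [^] n) = \<phi> w" using g by (simp add: \<phi>_pow)
    then have "w \<in> center G #> g [^] n"
      using w g repr_independenceD[OF subgroup_center] by (simp add: eq_iff C_def)
    then show ?thesis by (auto simp: r_coset_def)
  qed
  obtain z m where x: "z \<in> center G" "x = z \<otimes> g [^] (m::nat)" using dec assms(1) by blast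
  obtain w n where y: "w \<in> center G" "y = w \<otimes> g [^] (n::nat)" using dec assms(2) by blast
  have zw: "z \<in> carrier G" "w \<in> carrier G" using x y by (simp_all add: center_def)
  have z: "z \<otimes> u = u \<otimes> z" and w: "w \<otimes> u = u \<otimes> w" if "u \<in> carrier G" for u
    using x y that by (simp_all add: center_def)
  have gm: "g [^] m \<in> carrier G" and gn: "g [^] n \<in> carrier G" using g by simp_all
  have "x \<otimes> y = z \<otimes> (g [^] m \<otimes> w) \<otimes> g [^] n"
    using zw gm gn by (simp only: x y m_assoc m_closed)
  also have "\<dots> = (z \<otimes> w) \<otimes> (g [^] m \<otimes> g [^] n)"
    using zw gm gn by (simp only: w[OF gm, symmetric] m_assoc m_closed)
  also have "\<dots> = (w \<otimes> z) \<otimes> (g [^] n \<otimes> g [^] m)"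
    using g by (simp only: z[OF zw(2)] nat_pow_mult add.commute)
  also have "\<dots> = w \<otimes> (z \<otimes> g [^] n) \<otimes> g [^] m"
    using zw gm gn by (simp only: m_assoc m_closed)
  also have "\<dots> = y \<otimes> x"
    using zw gm gn by (simp only: z[OF gn] x y m_assoc m_closed)
  finally show ?thesis .
qed

lemma verts_eq: "carrier G - center G = (\<Union>c<6. C c)"
proof (intro Set.set_eqI iffI)
  fix x assume x: "x \<in> carrier G - center G"
  then have "\<phi> x \<in> carrier aff" "\<phi> x \<noteq> (1, 0)"
    using mem_center_iff surj by blast+
  then obtain c where "c < 6" "\<phi> x \<in> set (cyc_class c)" by (rule cyc_class_cover)
  then show "x \<in> (\<Union>c<6. C c)" using x by (auto simp: C_def)
next
  fix x assume "x \<in> (\<Union>c<6. C c)"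
  then obtain c where "c < 6" "x \<in> carrier G" "\<phi> x \<in> set (cyc_class c)" by (auto simp: C_def)
  then show "x \<in> carrier G - center G"
    using one_not_in_cyc_class[of c] mem_center_iff[of x] by auto
qed

text \<open>Commutation passes to the images in \<open>aff\<close>. Taking \<open>x\<close> and
  \<open>y\<close> equal shows that the classes are disjoint.\<close>

lemma same_class_if_commute:
  assumes "c < 6" "d < 6" "x \<in> C c" "y \<in> C d" "x \<otimes> y = y \<otimes> x"
  shows "c = d"
proof -
  have "aff_mult (\<phi> x) (\<phi> y) = aff_mult (\<phi> y) (\<phi> x)"
    using assms \<phi>_mult[of x y] \<phi>_mult[of y x] by (simp add: C_def)
  then show ?thesis using assms(3,4) cyc_class_commute[OF assms(1,2)] unfolding C_def by blast
qed

text \<open>A fiber is a coset of the center, and all cosets have the same size.\<close>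

lemma card_fiber:
  assumes "p \<in> carrier aff"
  shows "card {x \<in> carrier G. \<phi> x = p} = card (center G)"
proof -
  obtain g where g: "g \<in> carrier G" "\<phi> g = p" using assms unfolding surj[symmetric] by auto
  have "{x \<in> carrier G. \<phi> x = p} = center G #> g"
  proof (intro Set.set_eqI iffI)
    fix x assume "x \<in> {x \<in> carrier G. \<phi> x = p}"
    then show "x \<in> center G #> g"
      using g repr_independenceD[OF subgroup_center] by (metis (mono_tags) eq_iff mem_Collect_eq)
  next
    fix x assume x: "x \<in> center G #> g"
    then have "x \<in> carrier G"
      using g subgroup.subset[OF subgroup_center] r_coset_subset_G by blast
    then show "x \<in> {x \<in> carrier G. \<phi> x = p}"
      using g repr_independence[OF x g(1) subgroup_center] eq_iff by auto
  qed
  moreover have "center G #> g \<in> rcosets (center G)"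
    using g by (auto simp: RCOSETS_def)
  ultimately show ?thesis
    using card_rcosets_equal subgroup.subset[OF subgroup_center] by metis
qed

lemma card_C:
  assumes "c < 6"
  shows "card (C c) = (if c = 5 then 4 else 3) * card (center G)"
proof -
  have "C c = (\<Union>p\<in>set (cyc_class c). {x \<in> carrier G. \<phi> x = p})"
    by (auto simp: C_def)
  also have "card \<dots> = (\<Sum>p\<in>set (cyc_class c). card {x \<in> carrier G. \<phi> x = p})"
    by (rule card_UN_disjoint) (use finite_carrier in auto)
  also have "\<dots> = card (set (cyc_class c)) * card (center G)"
    using cyc_class_closed[OF assms] by (simp add: card_fiber)
  also have "card (set (cyc_class c)) = (if c = 5 then 4 else 3)"
    using distinct_card[OF cyc_class_distinct[OF assms]] by (simp add: length_cyc_class)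
  finally show ?thesis .
qed

lemma card_center_pos: "0 < card (center G)"
  using subgroup.finite_imp_card_positive[OF subgroup_center finite_carrier] .

lemma commuting_graph_cliques: "disjoint_union_of_cliques (commuting_graph G) C 6"
proof
  fix c :: nat assume "c < 6"
  then show "C c \<noteq> {}" using card_C[of c] card_center_pos by (auto split: if_splits)
next
  fix c d x assume "c < (6::nat)" "d < 6" "x \<in> C c" "x \<in> C d"
  then show "c = d" using same_class_if_commute by blast
next
  show "parcs (commuting_graph G) = {(x, y). x \<noteq> y \<and> (\<exists>c<6. x \<in> C c \<and> y \<in> C c)}"
    unfolding commuting_graph_def verts_eq
    using commute_same_class same_class_if_commute by auto blast
qed (auto simp: C_def finite_carrier commuting_graph_def verts_eq)

end

section \<open>From the isomorphism of the central quotient to the spectra\<close>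

lemma (in group) central_quotient_aff_if_iso_Sz2:
  assumes "finite (carrier G)" "G Mod (center G) \<cong> Sz2"
  obtains \<phi> where "central_quotient_aff G \<phi>"
proof -
  interpret Z: normal "center G" G by (rule center_normal)
  obtain h where h: "h \<in> iso (G Mod center G) Sz2"
    using assms(2) by (auto simp: is_iso_def)
  \<comment> \<open>Since \<open>f\<close> is injective on cosets, composing it with the coset map
    yields a map whose fibers are the cosets of the center.\<close>
  define f where "f = (\<lambda>U. sz_aff (h U))"
  have "f \<in> iso (G Mod center G) aff"
    using h sz_aff_iso unfolding iso_iff f_def
    by (auto simp: hom_def inj_on_def image_image Pi_def simp flip: image_comp[unfolded o_def])
  then have f: "f \<in> hom (G Mod center G) aff" "f ` carrier (G Mod center G) = carrier aff"
      "inj_on f (carrier (G Mod center G))"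
    by (simp_all add: iso_iff)
  have carr: "carrier (G Mod center G) = (\<lambda>x. center G #> x) ` carrier G"
    by (auto simp: FactGroup_def RCOSETS_def)
  have "central_quotient_aff G (\<lambda>x. f (center G #> x))"
  proof unfold_locales
    show "(\<lambda>x. f (center G #> x)) \<in> hom G aff"
      using Group.hom_compose[OF Z.r_coset_hom_Mod f(1)] by (simp add: o_def)
    show "(\<lambda>x. f (center G #> x)) ` carrier G = carrier aff"
      using f(2) unfolding carr by (simp add: image_image)
    show "f (center G #> x) = f (center G #> y) \<longleftrightarrow> center G #> x = center G #> y"
      if "x \<in> carrier G" "y \<in> carrier G" for x y
      using that f(3) unfolding carr by (auto simp: inj_on_def)
  qed (fact assms)
  then show thesis by (rule that)
qed

theorem theorem2p2:
  fixes G :: "('a, 'm) monoid_scheme"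
  assumes "group G" and "finite (carrier G)"
    and "G Mod (center G) \<cong> Sz2"
  shows "let z = card (center G) in
      L_spec (commuting_graph G) =
           replicate_mset 6 0
         + replicate_mset (4 * z - 1) (4 * of_nat z)
         + replicate_mset (15 * z - 5) (3 * of_nat z)
    \<and> Q_spec (commuting_graph G) =
           replicate_mset 1 (8 * of_nat z - 2)
         + replicate_mset (4 * z - 1) (4 * of_nat z - 2)
         + replicate_mset 5 (6 * of_nat z - 2)
         + replicate_mset (15 * z - 5) (3 * of_nat z - 2)"
proof -
  obtain \<phi> where "central_quotient_aff G \<phi>"
    using group.central_quotient_aff_if_iso_Sz2[OF assms] .
  then interpret central_quotient_aff G \<phi> .
  interpret \<Gamma>: disjoint_union_of_cliques "commuting_graph G" C 6
    by (rule commuting_graph_cliques)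
  define z where "z = card (center G)"
  have z: "0 < z" using card_center_pos by (simp add: z_def)
  \<comment> \<open>Index 5 is the translation clique on \<open>4 * z\<close> vertices; the other
    five indices are the point stabilizers, with \<open>3 * z\<close> vertices each.\<close>
  have six: "{..<6::nat} = {0, 1, 2, 3, 4, 5}" by auto
  \<comment> \<open>Each of the five smaller cliques contributes \<open>3 * z - 1\<close> copies of
    its repeated eigenvalue.\<close>
  have split: "replicate_mset (15 * z - 5) v = repeat_mset 5 (replicate_mset (3 * z - 1) v)"
    for v :: complex
    using z by (intro multiset_eqI) auto
  \<comment> \<open>The six zeros come from the six components, one each.\<close>
  have "L_spec (commuting_graph G) = replicate_mset 6 0
      + replicate_mset (4 * z - 1) (4 * of_nat z) + replicate_mset (15 * z - 5) (3 * of_nat z)"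
    unfolding \<Gamma>.L_spec six split by (intro multiset_eqI) (simp add: card_C flip: z_def)
  \<comment> \<open>The all-ones vectors give \<open>2 * (4 * z) - 2\<close> once and
    \<open>2 * (3 * z) - 2\<close> five times.\<close>
  moreover have "Q_spec (commuting_graph G) = replicate_mset 1 (8 * of_nat z - 2)
      + replicate_mset (4 * z - 1) (4 * of_nat z - 2) + replicate_mset 5 (6 * of_nat z - 2)
      + replicate_mset (15 * z - 5) (3 * of_nat z - 2)"
    unfolding \<Gamma>.Q_spec six split by (intro multiset_eqI) (simp add: card_C flip: z_def)
  ultimately show ?thesis by (simp add: z_def Let_def)
qed

end
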